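(* Let $h > 0$ be a real number, let $b \in \mathbb{R}^3$, let $$A = \frac{1}{h^2}\begin{bmatrix} 2 & -1 & 0\\ -1 & 2 & -1\\ 0 & -1 & 2\end{bmatrix},$$ and let $x = A^{-1} b$. Then for every $x_0 \in \mathbb{R}^3$, the Jacobi iterates $(x_k)_{k \ge 0}$ for $Ax=b$ started at $x_0$ satisfy $\lim_{k\to\infty} \|x_{k+1} - x\|_2 = 0$.
   Context: Write $A = M + N$, where $M = D$ is the diagonal part of $A$ and $N = A - D$ is the off-diagonal part of $A$. The Jacobi iterates started at $x_0$ are defined recursively by $x_{k+1} = -M^{-1} N x_k + M^{-1} b$ for $k \ge 0$. $\|\cdot\|_2$ is the Euclidean ($\ell^2$) vector norm. *)

theory Defs
  imports "HOL-Analysis.Analysis"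
begin

definition diag_part :: "real ^ 'n ^ 'n \<Rightarrow> real ^ 'n ^ 'n" where
  "diag_part A = (\<chi> i j. if i = j then A $ i $ j else 0)"

definition offdiag_part :: "real ^ 'n ^ 'n \<Rightarrow> real ^ 'n ^ 'n" where
  "offdiag_part A = A - diag_part A"

primrec jacobi_iterate ::
  "real ^ 'n ^ 'n \<Rightarrow> real ^ 'n \<Rightarrow> real ^ 'n \<Rightarrow> nat \<Rightarrow> real ^ 'n" where
  "jacobi_iterate A b x0 0 = x0"
| "jacobi_iterate A b x0 (Suc k) =
     - (matrix_inv (diag_part A) ** offdiag_part A *v jacobi_iterate A b x0 k)
     + matrix_inv (diag_part A) *v b"

end

theory Submission
  imports Defs
begin

text \<open>The error evolves by \<open>e \<mapsto> - M\<^sup>-\<^sup>1 N e\<close>, and here \<open>- M\<^sup>-\<^sup>1 N\<close> sends \<open>(u, v, w)\<close> to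
  \<open>(v / 2, (u + w) / 2, v / 2)\<close>: the factor \<open>1 / h\<^sup>2\<close> cancels. This matrix is symmetric with eigenvalues
  \<open>0\<close> and \<open>\<plusminus>1 / sqrt 2\<close>, so the Euclidean norm of the error shrinks at least by the factor
  \<open>1 / sqrt 2\<close> at each step.\<close>

text \<open>\<open>matrix_inv\<close> is a Hilbert choice among two-sided inverses. The witness
  \<open>B\<close> makes that choice meaningful, and associativity then forces the chosen matrix to
  be \<open>B\<close>.\<close>

lemma matrix_inv_unique:
  assumes "A ** B = mat 1" "B ** A = mat 1"
  shows "matrix_inv A = B"
proof -
  have inv: "A ** matrix_inv A = mat 1 \<and> matrix_inv A ** A = mat 1"
    unfolding matrix_inv_def
    by (rule someI[of "\<lambda>C. A ** C = mat 1 \<and> C ** A = mat 1" B]) (use assms in simp)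
  have "matrix_inv A = matrix_inv A ** (A ** B)"
    by (simp add: assms)
  also have "\<dots> = B"
    using inv by (simp add: matrix_mul_assoc)
  finally show ?thesis .
qed

lemma
  assumes "invertible A"
  shows matrix_inv_right: "A ** matrix_inv A = mat 1"
    and matrix_inv_left: "matrix_inv A ** A = mat 1"
  using assms unfolding invertible_def by (metis matrix_inv_unique)+

text \<open>Splitting \<open>A\<close> in \<open>A *v x = b\<close> shows that \<open>x\<close> is a
  fixed point of the iteration, so subtracting it cancels the term in \<open>b\<close> and leaves a
  linear recursion.\<close>

lemma jacobi_iterate_error_Suc:
  fixes A :: "real ^ 'n ^ 'n"
  assumes inv: "invertible (diag_part A)" and sol: "A *v x = b"
  shows "jacobi_iterate A b x0 (Suc k) - x =
    - (matrix_inv (diag_part A) *v (offdiag_part A *v (jacobi_iterate A b x0 k - x)))"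
proof -
  let ?D = "diag_part A"
  have "matrix_inv ?D *v b = matrix_inv ?D *v (?D *v x + offdiag_part A *v x)"
    by (simp add: offdiag_part_def matrix_vector_mult_diff_rdistrib sol)
  also have "\<dots> = x + matrix_inv ?D *v (offdiag_part A *v x)"
    by (simp add: matrix_vector_right_distrib matrix_vector_mul_assoc matrix_inv_left[OF inv])
  finally show ?thesis
    by (simp add: matrix_vector_mult_diff_distrib matrix_vector_mul_assoc[symmetric])
qed

lemma power2_norm_3: "(norm (y :: real ^ 3))\<^sup>2 = (y $ 1)\<^sup>2 + (y $ 2)\<^sup>2 + (y $ 3)\<^sup>2"
  unfolding power2_norm_eq_inner by (simp add: inner_vec_def sum_3 power2_eq_square)

text \<open>Geometric decay, phrased with squares so that a Euclidean norm can be estimated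
  coordinatewise; the square root is taken only in the limit.\<close>

lemma tendsto_zero_if_power2_contracts:
  fixes e :: "nat \<Rightarrow> 'a::real_normed_vector"
  assumes step: "\<And>k. (norm (e (Suc k)))\<^sup>2 \<le> c * (norm (e k))\<^sup>2" and c: "0 \<le> c" "c < 1"
  shows "(\<lambda>k. norm (e k)) \<longlonglongrightarrow> 0"
proof -
  have bound: "(norm (e k))\<^sup>2 \<le> c ^ k * (norm (e 0))\<^sup>2" for k
  proof (induction k)
    case (Suc k)
    have "(norm (e (Suc k)))\<^sup>2 \<le> c * (norm (e k))\<^sup>2" by (rule step)
    also have "\<dots> \<le> c * (c ^ k * (norm (e 0))\<^sup>2)"
      using Suc c by (intro mult_left_mono) auto
    finally show ?case by (simp add: mult.assoc)
  qed simp
  have "(\<lambda>k. c ^ k * (norm (e 0))\<^sup>2) \<longlonglongrightarrow> 0"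
    using c by (intro tendsto_mult_left_zero LIMSEQ_power_zero) auto
  then have "(\<lambda>k. (norm (e k))\<^sup>2) \<longlonglongrightarrow> 0"
    by (rule Lim_null_comparison[OF always_eventually, rotated]) (simp add: bound)
  then have "(\<lambda>k. sqrt ((norm (e k))\<^sup>2)) \<longlonglongrightarrow> sqrt 0"
    by (rule tendsto_real_sqrt)
  then show ?thesis by simp
qed

theorem mainTheorem3:
  fixes h :: real and A :: "real ^ 3 ^ 3" and b x :: "real ^ 3"
  assumes "h > 0"
    and "A = (1 / h\<^sup>2) *\<^sub>R vector [vector [2, -1, 0], vector [-1, 2, -1], vector [0, -1, 2]]"
    and "x = matrix_inv A *v b"
  shows "\<forall>x0 :: real ^ 3. (\<lambda>k. norm (jacobi_iterate A b x0 (k + 1) - x)) \<longlonglongrightarrow> 0"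
proof
  fix x0 :: "real ^ 3"
  let ?D = "diag_part A" and ?e = "\<lambda>k. jacobi_iterate A b x0 k - x"
  \<comment> \<open>The determinant is \<open>4 / h ^ 6\<close>.\<close>
  have "invertible A"
    using assms(1) by (simp add: invertible_det_nz det_3 assms(2) field_simps)
  then have sol: "A *v x = b"
    by (simp add: assms(3) matrix_vector_mul_assoc matrix_inv_right)
  have D: "?D = (2 / h\<^sup>2) *\<^sub>R mat 1"
    by (simp add: diag_part_def assms(2) mat_def vec_eq_iff forall_3)
  have D_left: "(h\<^sup>2 / 2) *\<^sub>R mat 1 ** ?D = mat 1" and D_right: "?D ** (h\<^sup>2 / 2) *\<^sub>R mat 1 = mat 1"
    using assms(1) by (simp_all add: D flip: scalar_matrix_assoc)
  have D_inv: "invertible ?D"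
    using D_left D_right by (auto simp: invertible_def)
  have inv_D: "matrix_inv ?D = (h\<^sup>2 / 2) *\<^sub>R mat 1"
    using D_left D_right by (intro matrix_inv_unique)
  have step:
    "- (matrix_inv ?D *v (offdiag_part A *v e)) = vector [e $ 2 / 2, (e $ 1 + e $ 3) / 2, e $ 2 / 2]"
    for e
  proof -
    have "offdiag_part A *v e = - (1 / h\<^sup>2) *\<^sub>R vector [e $ 2, e $ 1 + e $ 3, e $ 2]"
      by (simp add: offdiag_part_def diag_part_def assms(2) vec_eq_iff forall_3
          matrix_vector_mult_def sum_3 add_divide_distrib)
    moreover have "matrix_inv ?D *v y = (h\<^sup>2 / 2) *\<^sub>R y" for y
      by (simp add: inv_D flip: scaleR_matrix_vector_assoc)
    ultimately show ?thesis
      using assms(1) by (simp add: vec_eq_iff forall_3)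
  qed
  \<comment> \<open>The constant \<open>1 / 2\<close> is the square of the spectral radius
    \<open>1 / sqrt 2\<close>.\<close>
  have "(norm (?e (Suc k)))\<^sup>2 \<le> 1 / 2 * (norm (?e k))\<^sup>2" for k
  proof -
    let ?u = "?e k $ 1" and ?v = "?e k $ 2" and ?w = "?e k $ 3"
    have "?e (Suc k) = vector [?v / 2, (?u + ?w) / 2, ?v / 2]"
      unfolding jacobi_iterate_error_Suc[OF D_inv sol] by (rule step)
    then have "(norm (?e (Suc k)))\<^sup>2 = ?v\<^sup>2 / 2 + ((?u + ?w) / 2)\<^sup>2"
      by (simp only: power2_norm_3 vector_3) (simp add: power_divide)
    \<comment> \<open>The right side exceeds the left by exactly
      \<open>((?u - ?w) / 2)\<^sup>2\<close>.\<close>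
    also have "\<dots> \<le> 1 / 2 * (?u\<^sup>2 + ?v\<^sup>2 + ?w\<^sup>2)"
      using zero_le_power2[of "?u - ?w"] by (simp add: power2_eq_square field_simps)
    also have "\<dots> = 1 / 2 * (norm (?e k))\<^sup>2"
      by (simp only: power2_norm_3)
    finally show ?thesis .
  qed
  then have "(\<lambda>k. norm (?e k)) \<longlonglongrightarrow> 0"
    by (rule tendsto_zero_if_power2_contracts) auto
  then show "(\<lambda>k. norm (?e (k + 1))) \<longlonglongrightarrow> 0"
    by (rule LIMSEQ_ignore_initial_segment[where k = 1])
qed

end
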